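(* Let $\mathbb F$ be a field and let $$y=z^{\upsilon s},\qquad x=z^{\upsilon r}\bigl(1+z^{p}+\epsilon(z)\bigr),\qquad \mathrm{ord}_z\,\epsilon>p,$$ where $r>s$, $\gcd(r,s)=1$, $\gcd(p,\upsilon)=1$ ($r,s,\upsilon,p$ positive integers). If $\mathbb F$ has positive characteristic $\chi$, assume $\gcd(\chi,s)=1$. Put $h=x^{s}-y^{r}$ and let $J\subset\mathbb F[[x,y]]$ be the ideal generated by the generalized monomials $x^{a}y^{b}h^{c}$ ($a,b,c\ge0$) whose $z$-valuations are at least $2\delta$, where $$2\delta=\upsilon^2rs-\upsilon(r+s)+(\upsilon-1)p+1.$$ If $F(x,y)\in\mathbb F[[x,y]]$ is the reduced equation of the ring $\mathcal R=\mathbb F[[x(z),y(z)]]\subset\mathbb F[[z]]$, then $F\in J$; this conclusion is independent of the higher series $\epsilon(z)$. Accordingly, it suffices to pick, for each $k=2\delta,\ldots,2\delta+\nu(y)-1$, one generalized monomial $f_k$ with $\nu(f_k)=k$; the elements $f_k$ generate the whole $J$.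
   Context: $\nu=\mathrm{ord}_z$, and the $z$-valuation of an element of $\mathbb F[[x,y]]$ means the $z$-order of its image in $\mathbb F[[z]]$ under $x\mapsto x(z)$, $y\mapsto y(z)$; thus $\nu(x)=\upsilon r$, $\nu(y)=\upsilon s$, $\nu(h)=\upsilon rs+p$. The reduced equation $F$ is a generator of the kernel of the substitution homomorphism $\mathbb F[[x,y]]\to\mathbb F[[z]]$. *)

theory Defs
  imports
    "HOL-Computational_Algebra.Computational_Algebra"
    "HOL-Library.Extended_Nat"
begin

text \<open>The order of a power series, with order \<open>\<infinity>\<close> for the zero series
  (for which the library's \<^const>\<open>subdegree\<close> is 0).\<close>

definition fps_ord :: "'a::zero fps \<Rightarrow> enat" where
  "fps_ord f = (if f = 0 then \<infinity> else enat (subdegree f))"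

text \<open>The ring of power series in two variables \<open>x, y\<close> is rendered as \<^typ>\<open>'a fps fps\<close>:
  the outer variable is \<open>y\<close>, and the coefficients are power series in the inner variable \<open>x\<close>.\<close>

definition var_x :: "'a::comm_ring_1 fps fps" where
  "var_x = fps_const fps_X"

definition var_y :: "'a::comm_ring_1 fps fps" where
  "var_y = fps_X"

text \<open>The substitution \<open>G(x,y) \<mapsto> G(X(z),Y(z))\<close>, meaningful when \<open>X\<close> and \<open>Y\<close> have zero constant
  term. Then \<open>Y ^ j\<close> has order at least \<open>j\<close>, so the terms with \<open>j > n\<close> do not contribute to the
  \<open>n\<close>-th coefficient (the same truncation as in the library's \<^const>\<open>fps_compose\<close>).\<close>

definition subst2 :: "'a::comm_ring_1 fps \<Rightarrow> 'a fps \<Rightarrow> 'a fps fps \<Rightarrow> 'a fps" where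
  "subst2 X Y G = Abs_fps (\<lambda>n. \<Sum>j=0..n. fps_nth ((fps_nth G j oo X) * Y ^ j) n)"

lemma subst2_var_x: "fps_nth X 0 = 0 \<Longrightarrow> subst2 X Y var_x = X"
  by (rule fps_ext)
    (simp add: subst2_def var_x_def if_distrib[of "\<lambda>f. f oo X"] if_distrib[of "\<lambda>f. f * _"]
      if_distrib[of "\<lambda>f. fps_nth f _"] cong: if_cong)

lemma subst2_var_y: "fps_nth Y 0 = 0 \<Longrightarrow> subst2 X Y var_y = Y"
  by (rule fps_ext)
    (auto simp add: subst2_def var_y_def fps_X_def if_distrib[of "\<lambda>f. f oo X"]
      if_distrib[of "\<lambda>f. f * _"] if_distrib[of "\<lambda>f. fps_nth f _"] not_le less_Suc_eq_0_disj
      cong: if_cong)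

definition z_val :: "'a::comm_ring_1 fps \<Rightarrow> 'a fps \<Rightarrow> 'a fps fps \<Rightarrow> enat" where
  "z_val X Y G = fps_ord (subst2 X Y G)"

text \<open>The ideal generated by a set: the span in the ring regarded as a module over itself.\<close>

definition ideal_gen :: "'a::comm_ring_1 set \<Rightarrow> 'a set" where
  "ideal_gen S = module.span (*) S"

definition is_reduced_equation :: "'a::comm_ring_1 fps \<Rightarrow> 'a fps \<Rightarrow> 'a fps fps \<Rightarrow> bool" where
  "is_reduced_equation X Y F \<longleftrightarrow> ideal_gen {F} = {G. subst2 X Y G = 0}"

definition y_ser :: "nat \<Rightarrow> nat \<Rightarrow> 'a::comm_ring_1 fps" where
  "y_ser s u = fps_X ^ (u * s)"

definition x_ser :: "nat \<Rightarrow> nat \<Rightarrow> nat \<Rightarrow> 'a::comm_ring_1 fps \<Rightarrow> 'a fps" where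
  "x_ser r u p \<epsilon> = fps_X ^ (u * r) * (1 + fps_X ^ p + \<epsilon>)"

definition h_elt :: "nat \<Rightarrow> nat \<Rightarrow> 'a::comm_ring_1 fps fps" where
  "h_elt r s = var_x ^ s - var_y ^ r"

definition gen_monomials :: "nat \<Rightarrow> nat \<Rightarrow> 'a::comm_ring_1 fps fps set" where
  "gen_monomials r s = {var_x ^ a * var_y ^ b * h_elt r s ^ c | a b c. True}"

definition two_delta :: "nat \<Rightarrow> nat \<Rightarrow> nat \<Rightarrow> nat \<Rightarrow> nat" where
  "two_delta r s u p =
     nat ((int u)\<^sup>2 * int r * int s - int u * (int r + int s) + (int u - 1) * int p + 1)"

lemma int_two_delta:
  assumes "r > 0" "s > 0" "u > 0"
  shows "int (two_delta r s u p) =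
    (int u)\<^sup>2 * int r * int s - int u * (int r + int s) + (int u - 1) * int p + 1"
proof -
  have "0 \<le> (int u * int r - 1) * (int u * int s - 1) + (int u - 1) * int p"
    using assms by (intro add_nonneg_nonneg mult_nonneg_nonneg)
      (simp_all flip: of_nat_mult add: Suc_le_eq)
  also have "\<dots> = (int u)\<^sup>2 * int r * int s - int u * (int r + int s) + (int u - 1) * int p + 1"
    by (simp add: algebra_simps power2_eq_square)
  finally show ?thesis
    by (simp add: two_delta_def)
qed

definition J_ideal ::
  "nat \<Rightarrow> nat \<Rightarrow> nat \<Rightarrow> nat \<Rightarrow> 'a::comm_ring_1 fps \<Rightarrow> 'a fps fps set" where
  "J_ideal r s u p \<epsilon> =
     ideal_gen {g \<in> gen_monomials r s.
       z_val (x_ser r u p \<epsilon>) (y_ser s u) g \<ge> enat (two_delta r s u p)}"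

end

theory Submission
  imports Defs "HOL-Number_Theory.Cong"
begin

text \<open>
  Give \<open>x, y, h\<close> the weights \<open>ur, us, urs + p\<close>; the weight of a generalized monomial is its valuation,
  so \<open>J\<close> does not depend on \<open>\<epsilon>\<close>. As \<open>x\<^sup>s = h + y\<^sup>r\<close>, every series is congruent modulo \<open>J\<close> to a finite
  linear combination of monomials \<open>x\<^sup>a y\<^sup>b h\<^sup>c\<close> with \<open>a < s\<close> and weight below \<open>2\<delta>\<close>. Since \<open>h\<^sup>u\<close> has weight
  above \<open>2\<delta>\<close>, these have \<open>c < u\<close>, and so their weights are pairwise distinct. Hence no cancellation
  of leading terms is possible and \<open>J\<close> consists of all series of valuation at least \<open>2\<delta>\<close>; in
  particular it contains the kernel of the substitution.

  For the generators, \<open>h\<^sup>u = x \<cdot> x\<^bsup>s-1\<^esup> h\<^bsup>u-1\<^esup> - y \<cdot> y\<^bsup>r-1\<^esup> h\<^bsup>u-1\<^esup>\<close>, and both \<open>x\<^bsup>s-1\<^esup> h\<^bsup>u-1\<^esup>\<close> and \<open>y\<^bsup>r-1\<^esup> h\<^bsup>u-1\<^esup>\<close> are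
  multiples of some \<open>f\<^sub>k\<close> by a power of \<open>y\<close>. The remaining monomials of \<open>J\<close> follow by descending
  induction on \<open>c < u\<close>: a monomial and the multiple of an \<open>f\<^sub>k\<close> of the same weight have the same \<open>c\<close>,
  so their difference is a combination of monomials with exponent \<open>c + 1\<close>.
\<close>

section \<open>Orders of power series\<close>

lemma le_fps_ord_iff: "enat n \<le> fps_ord f \<longleftrightarrow> (\<forall>i<n. fps_nth f i = 0)"
  by (auto simp: fps_ord_def nth_less_subdegree_zero intro: subdegree_geI)

lemma fps_ord_eq_enat_iff:
  "fps_ord f = enat n \<longleftrightarrow> fps_nth f n \<noteq> 0 \<and> (\<forall>i<n. fps_nth f i = 0)"
  by (auto simp: fps_ord_def nth_less_subdegree_zero intro: subdegreeI)

lemma fps_ord_mult: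
  fixes f g :: "'a::semiring_no_zero_divisors fps"
  shows "fps_ord (f * g) = fps_ord f + fps_ord g"
  by (simp add: fps_ord_def)

lemma fps_ord_power:
  fixes f :: "'a::semiring_1_no_zero_divisors fps"
  assumes "fps_ord f = enat n"
  shows "fps_ord (f ^ k) = enat (n * k)"
  using assms by (auto simp: fps_ord_def split: if_splits)

text \<open>Among the terms with non-zero coefficient, the one of least weight has an order that no
  other such term shares or undercuts. Its leading coefficient survives in the sum, which would then
  have order below \<open>N\<close>.\<close>

lemma combination_eq_0_if_orders_distinct:
  fixes f :: "'b \<Rightarrow> 'a::field fps"
  assumes "finite T" "inj_on w T"
    and ord: "\<And>t. t \<in> T \<Longrightarrow> fps_ord (f t) = enat (w t)"
    and less: "\<And>t. t \<in> T \<Longrightarrow> w t < N"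
    and "enat N \<le> fps_ord (\<Sum>t\<in>T. fps_const (c t) * f t)"
    and "t \<in> T"
  shows "c t = 0"
proof (rule ccontr)
  assume "c t \<noteq> 0"
  define S where "S = {t \<in> T. c t \<noteq> 0}"
  have "t \<in> S"
    using \<open>t \<in> T\<close> \<open>c t \<noteq> 0\<close> by (simp add: S_def)
  then obtain m where m: "m \<in> S" and min: "\<And>t. t \<in> S \<Longrightarrow> w m \<le> w t"
    using arg_min_least[of S _ w] arg_min_if_finite(1)[of S w] \<open>finite T\<close>
    by (metis (no_types, lifting) S_def empty_iff finite_subset mem_Collect_eq subsetI)
  have mT: "m \<in> T" "c m \<noteq> 0"
    using m by (auto simp: S_def)
  have "c t * fps_nth (f t) (w m) = 0" if "t \<in> T - {m}" for t
  proof (cases "c t = 0")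
    case False
    then have "w m \<le> w t"
      using that by (intro min) (simp add: S_def)
    moreover have "w m \<noteq> w t"
      using that mT \<open>inj_on w T\<close> by (auto dest: inj_onD)
    ultimately show ?thesis
      using ord[of t] that by (simp add: fps_ord_eq_enat_iff)
  qed simp
  then have "(\<Sum>t\<in>T - {m}. c t * fps_nth (f t) (w m)) = 0"
    by (intro sum.neutral ballI)
  then have "(\<Sum>t\<in>T. c t * fps_nth (f t) (w m)) = c m * fps_nth (f m) (w m)"
    using \<open>finite T\<close> mT(1) by (simp add: sum.remove[of T m])
  then have "fps_nth (\<Sum>t\<in>T. fps_const (c t) * f t) (w m) \<noteq> 0"
    using ord[OF mT(1)] mT(2) by (simp add: fps_sum_nth fps_ord_eq_enat_iff)
  with less[OF mT(1)] assms(5) show False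
    by (simp add: le_fps_ord_iff)
qed

lemma fps_const_sum: "fps_const (sum f S) = (\<Sum>i\<in>S. fps_const (f i))"
  by (induction S rule: infinite_finite_induct) (simp_all flip: fps_const_add)

section \<open>The substitution homomorphism\<close>

text \<open>\<open>Y ^ j\<close> has order at least \<open>j\<close>, so the cut may be made at any
  \<open>N \<ge> n\<close>. One \<open>N\<close> then serves all coefficients up to
  \<open>N\<close>, as multiplicativity requires.\<close>

lemma nth_subst2:
  assumes "fps_nth Y 0 = 0" "n \<le> N"
  shows "fps_nth (subst2 X Y G) n = fps_nth (\<Sum>j=0..N. (fps_nth G j oo X) * Y ^ j) n"
proof -
  have "fps_nth ((fps_nth G j oo X) * Y ^ j) n = 0" if "j > n" for j
    using that startsby_zero_power_prefix[OF assms(1)]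
    by (auto simp: fps_mult_nth intro!: sum.neutral)
  then have "(\<Sum>j=0..N. fps_nth ((fps_nth G j oo X) * Y ^ j) n) =
      (\<Sum>j=0..n. fps_nth ((fps_nth G j oo X) * Y ^ j) n)"
    using assms(2) by (intro sum.mono_neutral_right) auto
  then show ?thesis
    by (simp add: subst2_def fps_sum_nth)
qed

lemma subst2_add: "subst2 X Y (G + H) = subst2 X Y G + subst2 X Y H"
  by (rule fps_ext) (simp add: subst2_def fps_compose_add_distrib distrib_right sum.distrib)

lemma subst2_0: "subst2 X Y 0 = 0"
  by (rule fps_ext) (simp add: subst2_def)

lemma subst2_diff: "subst2 X Y (G - H) = subst2 X Y G - subst2 X Y H"
  using subst2_add[of X Y "G - H" H] by (simp add: algebra_simps)

lemma subst2_sum: "subst2 X Y (sum f S) = (\<Sum>i\<in>S. subst2 X Y (f i))"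
  by (induction S rule: infinite_finite_induct) (simp_all add: subst2_0 subst2_add)

lemma subst2_const: "subst2 X Y (fps_const (fps_const k)) = fps_const k"
  by (rule fps_ext)
    (simp add: subst2_def if_distrib[of "\<lambda>f. f oo X"] if_distrib[of "\<lambda>f. f * _"]
      if_distrib[of "\<lambda>f. fps_nth f _"] cong: if_cong)

lemma subst2_1: "subst2 X Y 1 = 1"
  using subst2_const[of X Y 1] by simp

text \<open>Up to degree \<open>n\<close> both factors may be replaced by finite sums. Their product
  loses its terms with \<open>i + j > n\<close>, and grouping the remaining triangle by
  \<open>k = i + j\<close> gives the Cauchy product.\<close>

lemma subst2_mult:
  fixes X Y :: "'a::idom fps"
  assumes X: "fps_nth X 0 = 0" and Y: "fps_nth Y 0 = 0"
  shows "subst2 X Y (G * H) = subst2 X Y G * subst2 X Y H"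
proof (rule fps_ext)
  fix n
  define a where "a = (\<lambda>i. fps_nth G i oo X)"
  define b where "b = (\<lambda>i. fps_nth H i oo X)"
  define t where "t = (\<lambda>(i, j). a i * b j * Y ^ (i + j))"
  have t0: "fps_nth (t (i, j)) n = 0" if "n < i + j" for i j
    using that startsby_zero_power_prefix[OF Y]
    by (auto simp: t_def fps_mult_nth intro!: sum.neutral)
  have "fps_nth (subst2 X Y G * subst2 X Y H) n =
      fps_nth ((\<Sum>i=0..n. a i * Y ^ i) * (\<Sum>j=0..n. b j * Y ^ j)) n"
    unfolding fps_mult_nth a_def b_def by (intro sum.cong) (simp_all add: nth_subst2[OF Y, of _ n])
  also have "(\<Sum>i=0..n. a i * Y ^ i) * (\<Sum>j=0..n. b j * Y ^ j) = sum t ({0..n} \<times> {0..n})"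
    by (simp add: sum_product sum.cartesian_product t_def power_add mult_ac)
  also have "fps_nth \<dots> n = (\<Sum>q\<in>{(i, j). i + j \<le> n}. fps_nth (t q) n)"
    unfolding fps_sum_nth by (intro sum.mono_neutral_right) (auto intro: t0)
  also have "\<dots> = (\<Sum>k\<le>n. \<Sum>i\<le>k. fps_nth (t (i, k - i)) n)"
    using sum.triangle_reindex_eq[of "\<lambda>i j. fps_nth (t (i, j)) n" n]
    by (simp add: case_prod_unfold)
  also have "\<dots> = fps_nth (subst2 X Y (G * H)) n"
    by (simp add: subst2_def fps_mult_nth[of G] fps_compose_sum_distrib
        fps_compose_mult_distrib[OF X] a_def b_def t_def sum_distrib_right fps_sum_nth atLeast0AtMost)
  finally show "fps_nth (subst2 X Y (G * H)) n = fps_nth (subst2 X Y G * subst2 X Y H) n"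
    by simp
qed

lemma subst2_power:
  fixes X Y :: "'a::idom fps"
  assumes "fps_nth X 0 = 0" "fps_nth Y 0 = 0"
  shows "subst2 X Y (G ^ n) = subst2 X Y G ^ n"
  by (induction n) (simp_all add: subst2_1 subst2_mult[OF assms])

section \<open>Generated ideals\<close>

lemma module_times: "module ((*) :: 'a::comm_ring_1 \<Rightarrow> 'a \<Rightarrow> 'a)"
  by standard (simp_all add: algebra_simps)

lemma ideal_gen_superset: "x \<in> S \<Longrightarrow> x \<in> ideal_gen S"
  unfolding ideal_gen_def by (rule module.span_base[OF module_times])

lemma ideal_gen_0: "0 \<in> ideal_gen S"
  unfolding ideal_gen_def by (rule module.span_zero[OF module_times])

lemma ideal_gen_add: "x \<in> ideal_gen S \<Longrightarrow> y \<in> ideal_gen S \<Longrightarrow> x + y \<in> ideal_gen S"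
  unfolding ideal_gen_def by (rule module.span_add[OF module_times])

lemma ideal_gen_diff: "x \<in> ideal_gen S \<Longrightarrow> y \<in> ideal_gen S \<Longrightarrow> x - y \<in> ideal_gen S"
  unfolding ideal_gen_def by (rule module.span_diff[OF module_times])

lemma ideal_gen_mult: "x \<in> ideal_gen S \<Longrightarrow> k * x \<in> ideal_gen S"
  unfolding ideal_gen_def by (rule module.span_scale[OF module_times])

lemma ideal_gen_minimal:
  assumes "S \<subseteq> T" "0 \<in> T" "\<And>x y. x \<in> T \<Longrightarrow> y \<in> T \<Longrightarrow> x + y \<in> T"
    "\<And>k x. x \<in> T \<Longrightarrow> k * x \<in> T"
  shows "ideal_gen S \<subseteq> T"
  unfolding ideal_gen_def
  by (rule module.span_minimal[OF module_times assms(1)])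
    (use assms in \<open>auto simp: module.subspace_def[OF module_times]\<close>)

section \<open>Generalized monomials and their weights\<close>

locale two_pair_branch =
  fixes r s u p :: nat
  assumes r_pos: "r > 0" and s_pos: "s > 0" and u_pos: "u > 0" and p_pos: "p > 0"
    and coprime_rs: "coprime r s" and coprime_pu: "coprime p u"
begin

abbreviation D :: nat where
  "D \<equiv> two_delta r s u p"

definition wt :: "nat \<Rightarrow> nat \<Rightarrow> nat \<Rightarrow> nat" where
  "wt a b c = u * (r * a + s * b) + c * (u * r * s + p)"

definition mon :: "nat \<Rightarrow> nat \<Rightarrow> nat \<Rightarrow> 'a::comm_ring_1 fps fps" where
  "mon a b c = var_x ^ a * var_y ^ b * h_elt r s ^ c"

text \<open>The negative terms are moved to the left, so that later estimates stay within the
  natural numbers.\<close>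

lemma D_eq: "D + u * r + u * s + p = u * u * r * s + u * p + 1"
proof -
  have "int (D + u * r + u * s + p) = int (u * u * r * s + u * p + 1)"
    using int_two_delta[OF r_pos s_pos u_pos, of p]
    by (simp add: power2_eq_square algebra_simps)
  then show ?thesis
    by (simp only: of_nat_eq_iff)
qed

lemma mon_mult: "mon a b c * mon a' b' c' = mon (a + a') (b + b') (c + c')"
  by (simp add: mon_def power_add algebra_simps)

lemma mon_add_s: "mon (a + s) b c = mon a b (Suc c) + mon a (b + r) c"
  by (simp add: mon_def h_elt_def power_add algebra_simps)

lemma wt_add: "wt (a + a') (b + b') (c + c') = wt a b c + wt a' b' c'"
  by (simp add: wt_def algebra_simps)

text \<open>In \<open>x^s = h + y^r\<close>, trading \<open>x^s\<close> for \<open>y^r\<close> keeps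
  the weight, and trading it for \<open>h\<close> raises it by \<open>p\<close>.\<close>

lemma wt_add_s: "wt (a + s) b c + p = wt a b (Suc c)" "wt (a + s) b c = wt a (b + r) c"
  by (simp_all add: wt_def algebra_simps)

text \<open>By \<open>D_eq\<close>, \<open>h^u\<close> has weight
  \<open>D + u r + u s + p - 1\<close>. The surplus \<open>u s\<close> keeps these monomials out of
  the window of the generators \<open>f k\<close>, which therefore also have
  \<open>c < u\<close>.\<close>

lemma D_le_wt_if_u_le:
  assumes "u \<le> c"
  shows "D + u * s \<le> wt a b c"
proof -
  have "u * (u * r * s + p) \<le> c * (u * r * s + p)"
    using assms by (rule mult_right_mono) simp
  also have "\<dots> \<le> wt a b c"
    by (simp add: wt_def)
  finally have "u * u * r * s + u * p \<le> wt a b c"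
    by (simp add: algebra_simps)
  with D_eq p_pos show ?thesis
    by linarith
qed

text \<open>Modulo \<open>u\<close> the weight is \<open>c * p\<close>, and \<open>p\<close> is
  invertible there.\<close>

lemma wt_eqD:
  assumes eq: "wt a b c = wt a' b' c'" and "c < u" "c' < u"
  shows "c = c'" "r * a + s * b = r * a' + s * b'"
proof -
  have "wt a b c mod u = (c * p) mod u" for a b c
  proof -
    have "wt a b c = c * p + u * (r * a + s * b + c * r * s)"
      by (simp add: wt_def algebra_simps)
    then show ?thesis
      by simp
  qed
  with eq have "[c * p = c' * p] (mod u)"
    by (metis cong_def)
  then have "[c = c'] (mod u)"
    using coprime_pu by (simp add: cong_mult_rcancel_nat)
  then show "c = c'"
    using assms(2,3) by (simp add: cong_less_modulus_unique_nat)
  with eq u_pos show "r * a + s * b = r * a' + s * b'"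
    by (simp add: wt_def)
qed

lemma exponent_x_cong:
  assumes "r * a + s * b = r * a' + s * b'"
  shows "[a = a'] (mod s)"
proof -
  have "[r * a = r * a'] (mod s)"
    using assms unfolding cong_def by (metis mod_mult_self2)
  then show ?thesis
    using coprime_rs by (simp add: cong_mult_lcancel_nat)
qed

text \<open>Sylvester's bound for the semigroup generated by \<open>r\<close> and \<open>s\<close>.
  Take \<open>a < s\<close> with \<open>r a\<close> congruent to \<open>m\<close> modulo
  \<open>s\<close>. If \<open>r a > m\<close>, then
  \<open>m \<le> r a - s \<le> r s - r - s\<close>, against the hypothesis.\<close>

lemma semigroup_conductor:
  assumes "r * s < m + r + s"
  obtains a b where "m = r * a + s * b"
proof -
  obtain x where x: "[r * x = 1] (mod s)"
    using cong_solve_coprime_nat[OF coprime_rs] by auto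
  define a where "a = (x * m) mod s"
  have "[r * a = r * (x * m)] (mod s)"
    by (simp add: a_def cong_def mod_mult_right_eq)
  also have "[r * (x * m) = m] (mod s)"
    using cong_scalar_right[OF x, of m] by (simp add: mult.assoc)
  finally have cong: "[r * a = m] (mod s)" .
  have "a < s"
    using s_pos by (simp add: a_def)
  then have "r * Suc a \<le> r * s"
    by (intro mult_left_mono) simp_all
  have "r * a \<le> m"
  proof (rule ccontr)
    assume "\<not> r * a \<le> m"
    then have "s dvd r * a - m"
      using cong by (simp add: cong_altdef_nat)
    then have "s \<le> r * a - m"
      using \<open>\<not> r * a \<le> m\<close> by (intro dvd_imp_le) simp_all
    with \<open>r * Suc a \<le> r * s\<close> assms s_pos show False
      by simp
  qed
  then have "s dvd m - r * a"
    using cong by (simp add: cong_altdef_nat cong_sym_eq)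
  then obtain b where "m - r * a = s * b" ..
  with \<open>r * a \<le> m\<close> show thesis
    by (intro that[of a b]) simp
qed

lemma ex_wt_eq:
  assumes "D \<le> n"
  obtains a b c where "c < u" "wt a b c = n"
proof -
  obtain x where x: "[p * x = 1] (mod u)"
    using cong_solve_coprime_nat[OF coprime_pu] by auto
  define c where "c = (x * n) mod u"
  have "c < u"
    using u_pos by (simp add: c_def)
  have "[p * c = p * (x * n)] (mod u)"
    by (simp add: c_def cong_def mod_mult_right_eq)
  also have "[p * (x * n) = n] (mod u)"
    using cong_scalar_right[OF x, of n] by (simp add: mult.assoc)
  finally have "int u dvd int n - int (p * c)"
    by (simp add: cong_int_iff[symmetric] cong_iff_dvd_diff dvd_diff_commute)
  then have "int u dvd int n - int (p * c) - int u * (int c * int r * int s)"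
    by (rule dvd_diff) simp
  then obtain k where "int n - int (p * c) - int u * (int c * int r * int s) = int u * k" ..
  then have k: "int n = int u * k + int c * (int u * int r * int s + int p)"
    by (simp add: algebra_simps)
  \<comment> \<open>The worst case is \<open>c = u - 1\<close>. There \<open>n = D\<close> leaves
    \<open>u k = u (r s - r - s) + 1\<close>, so \<open>k\<close> always exceeds the bound of
    \<open>semigroup_conductor\<close>.\<close>
  have "int c * (int u * int r * int s + int p) \<le> (int u - 1) * (int u * int r * int s + int p)"
    using \<open>c < u\<close> by (intro mult_right_mono) simp_all
  moreover have "int D + int u * int r + int u * int s + int p =
      int u * int u * int r * int s + int u * int p + 1"
    using arg_cong[OF D_eq, of int] by simp
  ultimately have "int u * (int r * int s - int r - int s) < int u * k"
    using assms k u_pos by (simp add: algebra_simps)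
  then have less: "int r * int s - int r - int s < k"
    using u_pos by simp
  \<comment> \<open>This says \<open>r s - r - s \<ge> -1\<close>, so the strict bound on
    \<open>k\<close> makes it non-negative.\<close>
  moreover have "0 \<le> (int r - 1) * (int s - 1)"
    using r_pos s_pos by simp
  ultimately have "0 \<le> k"
    by (simp add: algebra_simps)
  then obtain m where m: "k = int m"
    by (metis zero_le_imp_eq_int)
  have "int (r * s) < int (m + r + s)"
    using less m by simp
  then obtain a b where ab: "m = r * a + s * b"
    using semigroup_conductor of_nat_less_iff by blast
  have "int n = int (wt a b c)"
    using k by (simp add: m ab wt_def algebra_simps)
  with \<open>c < u\<close> show thesis
    by (intro that[of c a b]) simp_all
qed

section \<open>The ideal J and valuations along a branch\<close>

definition J :: "'a::comm_ring_1 fps fps set" where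
  "J = ideal_gen {mon a b c | a b c. D \<le> wt a b c}"

lemma mon_in_J: "D \<le> wt a b c \<Longrightarrow> mon a b c \<in> J"
  unfolding J_def by (rule ideal_gen_superset) blast

lemma J_0: "0 \<in> J"
  unfolding J_def by (rule ideal_gen_0)

lemma J_add: "x \<in> J \<Longrightarrow> y \<in> J \<Longrightarrow> x + y \<in> J"
  unfolding J_def by (rule ideal_gen_add)

lemma J_mult: "x \<in> J \<Longrightarrow> k * x \<in> J"
  unfolding J_def by (rule ideal_gen_mult)

lemma fps_ord_x_ser:
  fixes \<epsilon> :: "'a::field fps"
  assumes "fps_ord \<epsilon> > enat p"
  shows "fps_ord (x_ser r u p \<epsilon>) = enat (u * r)"
proof -
  have "\<forall>i<Suc p. fps_nth \<epsilon> i = 0"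
    using assms by (simp flip: le_fps_ord_iff add: Suc_ile_eq)
  then have "fps_ord (1 + fps_X ^ p + \<epsilon>) = enat 0"
    using p_pos by (simp add: fps_ord_eq_enat_iff)
  moreover have "fps_ord (fps_X ^ (u * r) :: 'a fps) = enat (u * r)"
    by (simp add: fps_ord_eq_enat_iff)
  ultimately show ?thesis
    by (simp add: x_ser_def fps_ord_mult)
qed

lemma fps_ord_y_ser: "fps_ord (y_ser s u :: 'a::field fps) = enat (u * s)"
  by (simp add: y_ser_def fps_ord_eq_enat_iff)

text \<open>Once \<open>z^(u r s)\<close> is factored out, \<open>(1 + d) ^ s - 1 = d * v\<close>
  remains. The cofactor \<open>v\<close> has constant term \<open>s\<close>, non-zero in the field,
  so only the order \<open>p\<close> of \<open>d\<close> is added.\<close>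

lemma fps_ord_h_elt_image:
  fixes \<epsilon> :: "'a::field fps"
  assumes \<epsilon>: "fps_ord \<epsilon> > enat p" and s: "of_nat s \<noteq> (0::'a)"
  shows "fps_ord (x_ser r u p \<epsilon> ^ s - y_ser s u ^ r) = enat (u * r * s + p)"
proof -
  define d where "d = fps_X ^ p + \<epsilon>"
  define v where "v = (\<Sum>i<s. (1 + d) ^ i)"
  have \<epsilon>0: "\<forall>i<Suc p. fps_nth \<epsilon> i = 0"
    using \<epsilon> by (simp flip: le_fps_ord_iff add: Suc_ile_eq)
  have d: "fps_ord d = enat p"
    using \<epsilon>0 by (simp add: d_def fps_ord_eq_enat_iff)
  have "fps_nth d 0 = 0"
    using \<epsilon>0 p_pos by (simp add: d_def)
  then have "fps_nth v 0 = of_nat s"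
    by (simp add: v_def fps_sum_nth startsby_power)
  then have v: "fps_ord v = enat 0"
    using s by (simp add: fps_ord_eq_enat_iff)
  have "x_ser r u p \<epsilon> = fps_X ^ (u * r) * (1 + d)"
    by (simp add: x_ser_def d_def add.assoc)
  then have "x_ser r u p \<epsilon> ^ s - y_ser s u ^ r = fps_X ^ (u * r * s) * ((1 + d) ^ s - 1)"
    by (simp add: y_ser_def power_mult_distrib power_mult[symmetric] left_diff_distrib right_diff_distrib mult_ac)
  also have "(1 + d) ^ s - 1 = d * v"
    by (simp add: power_diff_1_eq v_def)
  finally have "x_ser r u p \<epsilon> ^ s - y_ser s u ^ r = fps_X ^ (u * r * s) * (d * v)" .
  moreover have "fps_ord (fps_X ^ (u * r * s) :: 'a fps) = enat (u * r * s)"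
    by (simp add: fps_ord_eq_enat_iff)
  ultimately show ?thesis
    using d v by (simp add: fps_ord_mult)
qed

context
  fixes \<epsilon> :: "'a::field fps"
  assumes \<epsilon>: "fps_ord \<epsilon> > enat p" and s_nonzero: "of_nat s \<noteq> (0::'a)"
begin

lemma x_ser_nth_0: "fps_nth (x_ser r u p \<epsilon>) 0 = 0"
  using r_pos u_pos by (simp add: x_ser_def)

lemma y_ser_nth_0: "fps_nth (y_ser s u :: 'a fps) 0 = 0"
  using s_pos u_pos by (simp add: y_ser_def)

lemmas branch_subst2_mult = subst2_mult[OF x_ser_nth_0 y_ser_nth_0]
  and branch_subst2_power = subst2_power[OF x_ser_nth_0 y_ser_nth_0]

lemma z_val_mon: "z_val (x_ser r u p \<epsilon>) (y_ser s u) (mon a b c) = enat (wt a b c)"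
proof -
  have "subst2 (x_ser r u p \<epsilon>) (y_ser s u) (mon a b c) =
      x_ser r u p \<epsilon> ^ a * y_ser s u ^ b * (x_ser r u p \<epsilon> ^ s - y_ser s u ^ r) ^ c"
    by (simp add: mon_def h_elt_def branch_subst2_mult branch_subst2_power subst2_diff
        subst2_var_x[OF x_ser_nth_0] subst2_var_y[OF y_ser_nth_0])
  then show ?thesis
    by (simp add: z_val_def fps_ord_mult fps_ord_power[OF fps_ord_x_ser[OF \<epsilon>]]
        fps_ord_power[OF fps_ord_y_ser] fps_ord_power[OF fps_ord_h_elt_image[OF \<epsilon> s_nonzero]]
        wt_def algebra_simps)
qed

text \<open>The valuations of the generators are weights, which do not involve \<epsilon>. This
  gives the independence of the higher series.\<close>

lemma J_ideal_eq: "J_ideal r s u p \<epsilon> = J"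
proof -
  have "{g \<in> gen_monomials r s. z_val (x_ser r u p \<epsilon>) (y_ser s u) g \<ge> enat D} =
      {mon a b c | a b c. D \<le> wt a b c}"
    unfolding gen_monomials_def mon_def[symmetric] by (auto simp: z_val_mon) blast
  then show ?thesis
    by (simp add: J_ideal_def J_def)
qed

text \<open>The series of valuation at least \<open>D\<close> form an ideal containing the
  generators. The converse is \<open>in_J_if_z_val_ge\<close>.\<close>

lemma z_val_ge_if_in_J:
  assumes "G \<in> J"
  shows "enat D \<le> z_val (x_ser r u p \<epsilon>) (y_ser s u) G"
proof -
  have "J \<subseteq> {G. enat D \<le> z_val (x_ser r u p \<epsilon>) (y_ser s u) G}"
    unfolding J_def
  proof (rule ideal_gen_minimal)
    show "{mon a b c | a b c. D \<le> wt a b c} \<subseteq> {G. enat D \<le> z_val (x_ser r u p \<epsilon>) (y_ser s u) G}"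
      by (auto simp: z_val_mon)
  next
    fix k G
    assume "G \<in> {G. enat D \<le> z_val (x_ser r u p \<epsilon>) (y_ser s u) G}"
    then show "k * G \<in> {G. enat D \<le> z_val (x_ser r u p \<epsilon>) (y_ser s u) G}"
      by (auto simp: z_val_def branch_subst2_mult fps_ord_mult intro: add_increasing)
  qed (auto simp: z_val_def subst2_0 subst2_add le_fps_ord_iff)
  with assms show ?thesis
    by blast
qed

section \<open>Normal forms modulo J\<close>

definition low_exponents :: "(nat \<times> nat \<times> nat) set" where
  "low_exponents = {(a, b, c). a < s \<and> wt a b c < D}"

definition low_comb :: "(nat \<times> nat \<times> nat \<Rightarrow> 'a) \<Rightarrow> 'a fps fps" where
  "low_comb k = (\<Sum>(a, b, c)\<in>low_exponents. fps_const (fps_const (k (a, b, c))) * mon a b c)"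

lemma finite_low_exponents: "finite low_exponents"
proof -
  have "low_exponents \<subseteq> {..<s} \<times> {..D} \<times> {..D}"
  proof clarsimp
    fix a b c
    assume "(a, b, c) \<in> low_exponents"
    then have "a < s" "wt a b c < D"
      by (simp_all add: low_exponents_def)
    moreover have "1 * b \<le> (u * s) * b" "c * 1 \<le> c * (u * r * s + p)"
      using u_pos s_pos p_pos by (intro mult_right_mono mult_left_mono; simp add: Suc_le_eq)+
    moreover have "(u * s) * b + c * (u * r * s + p) \<le> wt a b c"
      by (simp add: wt_def algebra_simps)
    ultimately show "a < s \<and> b \<le> D \<and> c \<le> D"
      by linarith
  qed
  then show ?thesis
    by (rule finite_subset) simp
qed

text \<open>A weight below \<open>D\<close> forces \<open>c < u\<close>. The weight then determines
  \<open>c\<close> modulo \<open>u\<close>, next \<open>a\<close> modulo \<open>s\<close>, and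
  finally \<open>b\<close>.\<close>

lemma inj_on_wt_low_exponents: "inj_on (\<lambda>(a, b, c). wt a b c) low_exponents"
proof (rule inj_onI)
  fix t t'
  assume "t \<in> low_exponents" "t' \<in> low_exponents"
    and "(\<lambda>(a, b, c). wt a b c) t = (\<lambda>(a, b, c). wt a b c) t'"
  moreover obtain a b c a' b' c' where t: "t = (a, b, c)" "t' = (a', b', c')"
    by (metis prod_cases3)
  ultimately have *: "(a, b, c) \<in> low_exponents" "(a', b', c') \<in> low_exponents"
    and eq: "wt a b c = wt a' b' c'"
    by simp_all
  have lt: "a < s" "a' < s" "c < u" "c' < u"
    using * D_le_wt_if_u_le[of c a b] D_le_wt_if_u_le[of c' a' b']
    by (auto simp: low_exponents_def not_le[symmetric])
  note c = wt_eqD[OF eq lt(3,4)]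
  moreover have a: "a = a'"
    using exponent_x_cong[OF c(2)] lt by (simp add: cong_less_modulus_unique_nat)
  moreover have "b = b'"
    using c(2) s_pos by (simp add: a)
  ultimately show "t = t'"
    by (simp add: t)
qed

definition reducible :: "'a fps fps \<Rightarrow> bool" where
  "reducible G \<longleftrightarrow> (\<exists>k. \<exists>j\<in>J. G = low_comb k + j)"

lemma reducible_J: "G \<in> J \<Longrightarrow> reducible G"
  unfolding reducible_def
  by (rule exI[of _ "\<lambda>_. 0"]) (simp add: low_comb_def case_prod_unfold)

lemma reducible_add:
  assumes "reducible G" "reducible H"
  shows "reducible (G + H)"
proof -
  obtain k j k' j' where "j \<in> J" "j' \<in> J" and eq: "G = low_comb k + j" "H = low_comb k' + j'"
    using assms unfolding reducible_def by blast
  have "G + H = low_comb (\<lambda>t. k t + k' t) + (j + j')"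
    unfolding eq low_comb_def case_prod_unfold
    by (simp add: sum.distrib distrib_right flip: fps_const_add)
  with J_add[OF \<open>j \<in> J\<close> \<open>j' \<in> J\<close>] show ?thesis
    unfolding reducible_def by blast
qed

lemma reducible_sum: "(\<And>i. i \<in> S \<Longrightarrow> reducible (f i)) \<Longrightarrow> reducible (sum f S)"
  by (induction S rule: infinite_finite_induct)
    (simp_all add: reducible_add reducible_J J_0)

text \<open>As long as \<open>a \<ge> s\<close>, the relation \<open>x^s = h + y^r\<close> replaces
  the monomial by two with exponent \<open>a - s\<close>.\<close>

lemma reducible_mon: "reducible (fps_const (fps_const k) * mon a b c)"
proof (induction a arbitrary: b c rule: less_induct)
  case (less a)
  consider "D \<le> wt a b c" | "(a, b, c) \<in> low_exponents" | "s \<le> a"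
    by (force simp: low_exponents_def)
  then show ?case
  proof cases
    case 1
    then show ?thesis
      by (intro reducible_J J_mult mon_in_J)
  next
    case 2
    have "low_comb (\<lambda>t. if t = (a, b, c) then k else 0) =
        (\<Sum>t\<in>low_exponents. if t = (a, b, c) then fps_const (fps_const k) * mon a b c else 0)"
      unfolding low_comb_def by (rule sum.cong) (auto split: if_splits)
    also have "\<dots> = fps_const (fps_const k) * mon a b c"
      using 2 by (simp add: finite_low_exponents)
    finally show ?thesis
      unfolding reducible_def
      by (intro exI[of _ "\<lambda>t. if t = (a, b, c) then k else 0"] bexI[of _ 0])
        (simp_all add: J_0)
  next
    case 3
    then have "mon a b c = mon (a - s) b (Suc c) + (mon (a - s) (b + r) c :: 'a fps fps)"
      using mon_add_s[of "a - s"] by simp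
    then show ?thesis
      using 3 s_pos less.IH[of "a - s"] by (simp add: distrib_left reducible_add)
  qed
qed

text \<open>Both \<open>var_x ^ D\<close> and \<open>var_y ^ D\<close> lie in \<open>J\<close>.
  Cutting off at \<open>D\<close>, first in y and then in the coefficients, leaves finitely many
  monomials.\<close>

lemma reducible_all: "reducible G"
proof -
  have x: "var_x ^ D \<in> (J :: 'a fps fps set)"
    using mon_in_J[of D 0 0] r_pos u_pos by (simp add: wt_def mon_def)
  have y: "var_y ^ D \<in> (J :: 'a fps fps set)"
    using mon_in_J[of 0 D 0] s_pos u_pos by (simp add: wt_def mon_def)
  have coeff: "reducible (fps_const g * var_y ^ j)" for g :: "'a fps" and j
  proof -
    have "g = fps_shift D g * fps_X ^ D + fps_cutoff D g"
      by (simp add: fps_shift_cutoff)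
    also have "fps_cutoff D g = (\<Sum>i<D. fps_const (fps_nth g i) * fps_X ^ i)"
      by (rule fps_ext) (simp add: fps_sum_nth if_distrib cong: if_cong)
    finally have "fps_const g =
        fps_const (fps_shift D g * fps_X ^ D + (\<Sum>i<D. fps_const (fps_nth g i) * fps_X ^ i))"
      by (rule arg_cong)
    also have "\<dots> = fps_const (fps_shift D g) * var_x ^ D +
        (\<Sum>i<D. fps_const (fps_const (fps_nth g i)) * var_x ^ i)"
      by (simp add: var_x_def fps_const_sum flip: fps_const_add)
    finally have "fps_const g * var_y ^ j = (fps_const (fps_shift D g) * var_x ^ D +
        (\<Sum>i<D. fps_const (fps_const (fps_nth g i)) * var_x ^ i)) * var_y ^ j"
      by (rule arg_cong)
    also have "\<dots> = (fps_const (fps_shift D g) * var_y ^ j) * var_x ^ D +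
        (\<Sum>i<D. fps_const (fps_const (fps_nth g i)) * mon i j 0)"
      by (simp add: mon_def sum_distrib_left algebra_simps)
    finally have "fps_const g * var_y ^ j = (fps_const (fps_shift D g) * var_y ^ j) * var_x ^ D +
        (\<Sum>i<D. fps_const (fps_const (fps_nth g i)) * mon i j 0)" .
    moreover have "reducible (\<Sum>i<D. fps_const (fps_const (fps_nth g i)) * mon i j 0)"
      by (intro reducible_sum reducible_mon)
    moreover have "reducible (fps_const (fps_shift D g) * var_y ^ j * var_x ^ D)"
      using x by (intro reducible_J J_mult)
    ultimately show ?thesis
      by (simp only: reducible_add)
  qed
  have "G = fps_shift D G * var_y ^ D + fps_cutoff D G"
    by (simp add: fps_shift_cutoff var_y_def)
  also have "fps_cutoff D G = (\<Sum>j<D. fps_const (fps_nth G j) * var_y ^ j)"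
    by (rule fps_ext) (simp add: var_y_def fps_sum_nth if_distrib cong: if_cong)
  finally have "G = fps_shift D G * var_y ^ D + (\<Sum>j<D. fps_const (fps_nth G j) * var_y ^ j)" .
  moreover have "reducible (fps_shift D G * var_y ^ D)"
    using y by (intro reducible_J J_mult)
  moreover have "reducible (\<Sum>j<D. fps_const (fps_nth G j) * var_y ^ j)"
    by (intro reducible_sum coeff)
  ultimately show ?thesis
    using reducible_add by metis
qed

text \<open>The normal form of \<open>G\<close> differs from \<open>G\<close> by an element of
  \<open>J\<close>, so its valuation is at least \<open>D\<close> too. Its terms have distinct
  orders below \<open>D\<close>, hence all its coefficients vanish.\<close>

lemma in_J_if_z_val_ge:
  assumes "enat D \<le> z_val (x_ser r u p \<epsilon>) (y_ser s u) G"
  shows "G \<in> J"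
proof -
  let ?S = "subst2 (x_ser r u p \<epsilon>) (y_ser s u)"
  obtain k j where G: "G = low_comb k + j" and "j \<in> J"
    using reducible_all unfolding reducible_def by blast
  have "low_comb k = G - j"
    by (simp add: G)
  then have "?S (low_comb k) = ?S G - ?S j"
    by (simp add: subst2_diff)
  with assms z_val_ge_if_in_J[OF \<open>j \<in> J\<close>] have "enat D \<le> fps_ord (?S (low_comb k))"
    by (simp add: z_val_def le_fps_ord_iff)
  then have ge: "enat D \<le> fps_ord (\<Sum>t\<in>low_exponents. fps_const (k t) * ?S (case t of (a, b, c) \<Rightarrow> mon a b c))"
    by (simp add: low_comb_def subst2_sum branch_subst2_mult subst2_const case_prod_unfold)
  have "k t = 0" if "t \<in> low_exponents" for t
    by (rule combination_eq_0_if_orders_distinct[OF finite_low_exponents inj_on_wt_low_exponents _ _ ge that])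
      (auto simp: z_val_mon[unfolded z_val_def] low_exponents_def)
  then have "low_comb k = 0"
    unfolding low_comb_def by (auto intro!: sum.neutral)
  with G \<open>j \<in> J\<close> show ?thesis
    by simp
qed

end

section \<open>Generators of J from a window of weights\<close>

lemma ideal_gen_eq_J:
  fixes f :: "nat \<Rightarrow> 'a::comm_ring_1 fps fps"
  assumes f: "\<And>k. k \<in> {D..<D + u * s} \<Longrightarrow> \<exists>a b c. f k = mon a b c \<and> wt a b c = k"
  shows "ideal_gen (f ` {D..<D + u * s}) = J"
proof -
  define I where "I = ideal_gen (f ` {D..<D + u * s})"
  note I_closed = ideal_gen_0[of "f ` {D..<D + u * s}", folded I_def]
    ideal_gen_add[of _ "f ` {D..<D + u * s}", folded I_def]
    ideal_gen_diff[of _ "f ` {D..<D + u * s}", folded I_def]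
    ideal_gen_mult[of _ "f ` {D..<D + u * s}", folded I_def]
  \<comment> \<open>On dividing by the weight \<open>u * s\<close> of y, the remainder selects
    \<open>f k\<close> and the quotient is the power of y. Equality of weights gives the same
    \<open>c\<close>, but \<open>a\<close> and \<open>b\<close> may change; only
    \<open>r * a + s * b\<close> is preserved.\<close>
  have multiple: "\<exists>a' b'. mon a' b' c \<in> I \<and> r * a + s * b = r * a' + s * b'"
    if "D \<le> wt a b c" "c < u" for a b c
  proof -
    define k where "k = D + (wt a b c - D) mod (u * s)"
    define j where "j = (wt a b c - D) div (u * s)"
    have k: "k \<in> {D..<D + u * s}"
      using u_pos s_pos by (simp add: k_def)
    have "wt a b c - D = (wt a b c - D) mod (u * s) + wt 0 j 0"
      by (simp add: j_def wt_def[of 0] flip: mult.assoc)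
    then have wt: "wt a b c = k + wt 0 j 0"
      using that(1) by (simp add: k_def)
    obtain a' b' c' where fk: "f k = mon a' b' c'" and wtk: "wt a' b' c' = k"
      using f[OF k] by blast
    have "c' < u"
      using k D_le_wt_if_u_le[of c' a' b'] by (metis atLeastLessThan_iff not_le wtk)
    have "wt a b c = wt a' (b' + j) c'"
      using wt_add[of a' 0 b' j c' 0] by (simp add: wt wtk)
    note eq = wt_eqD[OF this \<open>c < u\<close> \<open>c' < u\<close>]
    have "f k \<in> I"
      unfolding I_def using k by (intro ideal_gen_superset imageI)
    then have "mon 0 j 0 * mon a' b' c' \<in> I"
      unfolding fk by (rule I_closed(4))
    then have "mon a' (b' + j) c \<in> I"
      by (simp add: mon_mult eq(1) add.commute)
    with eq(2) show ?thesis
      by blast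
  qed
  \<comment> \<open>By \<open>D_eq\<close> the two weights are \<open>D + u * s - 1\<close> and
    \<open>D + u * r - 1\<close>.\<close>
  have D_le: "D \<le> wt (s - 1) 0 (u - 1)" "D \<le> wt 0 (r - 1) (u - 1)"
  proof -
    have "wt (s - 1) 0 (u - 1) + u * r + p = u * u * r * s + u * p"
      unfolding wt_def using s_pos u_pos by (cases s; cases u) (auto simp: algebra_simps)
    moreover have "wt 0 (r - 1) (u - 1) + u * s + p = u * u * r * s + u * p"
      unfolding wt_def using r_pos u_pos by (cases r; cases u) (auto simp: algebra_simps)
    moreover have "0 < u * r" "0 < u * s"
      using r_pos s_pos u_pos by simp_all
    ultimately show "D \<le> wt (s - 1) 0 (u - 1)" "D \<le> wt 0 (r - 1) (u - 1)"
      using D_eq by linarith+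
  qed
  \<comment> \<open>The equation forces \<open>a < s\<close> with \<open>a\<close> congruent to
    \<open>s - 1\<close>, so the monomial supplied by \<open>multiple\<close> is this very one. The
    next monomial is settled likewise with \<open>a = 0\<close>.\<close>
  have "mon (s - 1) 0 (u - 1) \<in> I"
  proof -
    obtain a b where ab: "mon a b (u - 1) \<in> I" "r * (s - 1) + s * 0 = r * a + s * b"
      using multiple[OF D_le(1)] u_pos by auto
    have "r * a \<le> r * (s - 1)"
      using ab(2) by linarith
    then have "a < s"
      using r_pos s_pos by auto
    then have "a = s - 1"
      using cong_less_modulus_unique_nat[OF exponent_x_cong[OF ab(2)]] s_pos by simp
    with ab s_pos show ?thesis
      by simp
  qed
  moreover have "mon 0 (r - 1) (u - 1) \<in> I"
  proof -
    obtain a b where ab: "mon a b (u - 1) \<in> I" "r * 0 + s * (r - 1) = r * a + s * b"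
      using multiple[OF D_le(2)] u_pos by auto
    have "r * a \<le> s * (r - 1)"
      using ab(2) by linarith
    also have "\<dots> < r * s"
      using r_pos s_pos by (simp add: mult.commute)
    finally have "a < s"
      using r_pos by simp
    then have "a = 0"
      using cong_less_modulus_unique_nat[OF exponent_x_cong[OF ab(2)]] s_pos by simp
    with ab s_pos show ?thesis
      by simp
  qed
  \<comment> \<open>The difference is \<open>(x^s - y^r) h^(u-1) = h^u\<close>.\<close>
  ultimately have "mon 1 0 0 * mon (s - 1) 0 (u - 1) - mon 0 1 0 * mon 0 (r - 1) (u - 1) \<in> I"
    by (intro I_closed(3,4))
  then have "mon s 0 (u - 1) - mon 0 r (u - 1) \<in> I"
    using r_pos s_pos by (simp add: mon_mult)
  moreover have "mon s 0 (u - 1) = mon 0 0 u + (mon 0 r (u - 1) :: 'a fps fps)"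
    using mon_add_s[of 0 0 "u - 1"] u_pos by simp
  ultimately have h: "mon 0 0 u \<in> I"
    by simp
  \<comment> \<open>Each trade of \<open>x^s\<close> for \<open>y^r\<close> costs a monomial with
    exponent \<open>c + 1\<close> of \<open>h\<close> and weight larger by \<open>p\<close>, which
    lies in \<open>I\<close> by the first assumption; the \<open>t\<close> trades telescope.\<close>
  have exchange: "mon (a + s * t) b c - mon a (b + r * t) c \<in> I"
    if "\<And>a b. D \<le> wt a b (Suc c) \<Longrightarrow> mon a b (Suc c) \<in> I" and "D \<le> wt (a + s * t) b c"
    for a b c t
    using that(2)
  proof (induction t arbitrary: b)
    case 0
    show ?case
      by (simp add: I_closed(1))
  next
    case (Suc t)
    have eq: "a + s * Suc t = (a + s * t) + s" "b + r * Suc t = (b + r) + r * t"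
      by simp_all
    have "mon (a + s * t) b (Suc c) \<in> I"
      using Suc.prems wt_add_s(1)[of "a + s * t" b c] unfolding eq by (intro that(1)) linarith
    moreover have "mon (a + s * t) (b + r) c - mon a ((b + r) + r * t) c \<in> I"
      using Suc.prems wt_add_s(2)[of "a + s * t" b c] unfolding eq by (intro Suc.IH) linarith
    ultimately have "mon (a + s * t) b (Suc c) +
        (mon (a + s * t) (b + r) c - mon a ((b + r) + r * t) c) \<in> I"
      by (rule I_closed(2))
    then show ?case
      unfolding eq mon_add_s by (simp add: algebra_simps)
  qed
  have "mon a b c \<in> I" if "D \<le> wt a b c" for a b c
    using that
  \<comment> \<open>Truncated subtraction lets the base case cover every \<open>c \<ge> u\<close>,
    where the monomial is a multiple of \<open>h^u\<close>.\<close>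
  proof (induction "u - c" arbitrary: a b c)
    case 0
    have "mon a b (c - u) * mon 0 0 u \<in> I"
      by (rule I_closed(4)[OF h])
    moreover have "c - u + u = c"
      using 0(1) by linarith
    ultimately show ?case
      by (simp only: mon_mult add_0_left add_0_right)
  next
    case (Suc n)
    have c: "c < u" "n = u - Suc c"
      using Suc.hyps(2) by linarith+
    have IH: "mon a b (Suc c) \<in> I" if "D \<le> wt a b (Suc c)" for a b
      using Suc.hyps(1)[OF c(2) that] .
    have "\<exists>a' b'. mon a' b' c \<in> I \<and> r * a + s * b = r * a' + s * b'"
      using Suc.prems c(1) by (rule multiple)
    then obtain a' b' where ab: "mon a' b' c \<in> I" "r * a + s * b = r * a' + s * b'"
      by blast
    have cong: "[a = a'] (mod s)"
      by (rule exponent_x_cong[OF ab(2)])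
    have wt: "D \<le> wt a' b' c"
      using Suc.prems unfolding wt_def ab(2) .
    have "mon a b c - mon a' b' c \<in> I"
    \<comment> \<open>The exponent pairs differ by a multiple of \<open>(s, -r)\<close>. As
      \<open>exchange\<close> only lowers the exponent of x, it starts from the pair with the larger
      one.\<close>
    proof (cases "a' \<le> a")
      case True
      then have "s dvd a - a'"
        using cong by (simp add: cong_altdef_nat)
      then obtain t where "a - a' = s * t" ..
      with True have t: "a = a' + s * t"
        by simp
      have "s * b' = s * (b + r * t)"
        using ab(2) by (simp add: t algebra_simps)
      then have b': "b' = b + r * t"
        using s_pos by simp
      have "mon (a' + s * t) b c - mon a' (b + r * t) c \<in> I"
        by (rule exchange[OF IH]) (use Suc.prems t in simp_all)
      then show ?thesis
        by (simp only: t b')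
    next
      case False
      then have "s dvd a' - a"
        using cong_sym[OF cong] by (simp add: cong_altdef_nat)
      then obtain t where "a' - a = s * t" ..
      with False have t: "a' = a + s * t"
        by simp
      have "s * b = s * (b' + r * t)"
        using ab(2) by (simp add: t algebra_simps)
      then have b: "b = b' + r * t"
        using s_pos by simp
      have "mon (a + s * t) b' c - mon a (b' + r * t) c \<in> I"
        by (rule exchange[OF IH]) (use wt t in simp_all)
      then have "mon a' b' c - mon a b c \<in> I"
        by (simp only: t b)
      then have "0 - (mon a' b' c - mon a b c) \<in> I"
        by (rule I_closed(3)[OF I_closed(1)])
      then show ?thesis
        by simp
    qed
    then have "(mon a b c - mon a' b' c) + mon a' b' c \<in> I"
      using ab(1) by (rule I_closed(2))
    then show ?case
      by simp
  qed
  then have "J \<subseteq> I"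
    unfolding J_def by (intro ideal_gen_minimal I_closed) blast+
  moreover have "f k \<in> J" if "k \<in> {D..<D + u * s}" for k
    using f[OF that] that by (auto intro: mon_in_J)
  then have "I \<subseteq> J"
    unfolding I_def by (intro ideal_gen_minimal J_0 J_add J_mult) blast+
  ultimately show ?thesis
    by (simp add: I_def)
qed

end

theorem theoremC1:
  fixes r s u p :: nat and \<epsilon> :: "'a::field fps"
  assumes "r > 0" and "s > 0" and "u > 0" and "p > 0"
    and "r > s" and "coprime r s" and "coprime p u"
    and "CHAR('a) > 0 \<Longrightarrow> coprime CHAR('a) s"
    and "fps_ord \<epsilon> > enat p"
  shows "(\<forall>F. is_reduced_equation (x_ser r u p \<epsilon>) (y_ser s u) F \<longrightarrow> F \<in> J_ideal r s u p \<epsilon>)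
    \<and> (\<forall>\<epsilon>' F. fps_ord \<epsilon>' > enat p \<and> is_reduced_equation (x_ser r u p \<epsilon>') (y_ser s u) F
          \<longrightarrow> F \<in> J_ideal r s u p \<epsilon>)
    \<and> (\<forall>k \<in> {two_delta r s u p ..< two_delta r s u p + u * s}.
          \<exists>g \<in> gen_monomials r s. z_val (x_ser r u p \<epsilon>) (y_ser s u) g = enat k)
    \<and> (\<forall>f :: nat \<Rightarrow> 'a fps fps.
          (\<forall>k \<in> {two_delta r s u p ..< two_delta r s u p + u * s}.
             f k \<in> gen_monomials r s \<and> z_val (x_ser r u p \<epsilon>) (y_ser s u) (f k) = enat k)
          \<longrightarrow> ideal_gen (f ` {two_delta r s u p ..< two_delta r s u p + u * s})
              = J_ideal r s u p \<epsilon>)"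
proof -
  interpret two_pair_branch r s u p
    using assms by unfold_locales
  \<comment> \<open>A characteristic dividing \<open>s > 0\<close> is positive, hence coprime to
    \<open>s\<close> and so equal to 1, which no field allows.\<close>
  have s: "of_nat s \<noteq> (0::'a)"
  proof
    assume "of_nat s = (0::'a)"
    then have "CHAR('a) dvd s"
      by (simp add: of_nat_eq_0_iff_char_dvd)
    with \<open>s > 0\<close> assms(8) have "CHAR('a) = 1"
      by (metis coprime_common_divisor_nat dvd_0_left_iff dvd_refl gr0I)
    then show False
      by simp
  qed
  note J_eq = J_ideal_eq[OF assms(9) s]
  note z_val = z_val_mon[OF assms(9) s]
  \<comment> \<open>The image of \<open>F\<close> is zero and has order infinity, so
    \<open>F\<close> lies in \<open>J\<close> by the criterion for \<open>\<epsilon>'\<close>; this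
    \<open>J\<close> is also the ideal for \<epsilon>.\<close>
  have F: "F \<in> J_ideal r s u p \<epsilon>"
    if "fps_ord \<epsilon>' > enat p" "is_reduced_equation (x_ser r u p \<epsilon>') (y_ser s u) F"
    for \<epsilon>' F
  proof -
    have "F \<in> ideal_gen {F}"
      by (simp add: ideal_gen_superset)
    then have "subst2 (x_ser r u p \<epsilon>') (y_ser s u) F = 0"
      using that(2) by (simp add: is_reduced_equation_def)
    then show ?thesis
      unfolding J_eq by (intro in_J_if_z_val_ge[OF that(1) s]) (simp add: z_val_def fps_ord_def)
  qed
  have ex: "\<exists>g \<in> gen_monomials r s. z_val (x_ser r u p \<epsilon>) (y_ser s u) g = enat k"
    if "k \<in> {two_delta r s u p ..< two_delta r s u p + u * s}" for k
  proof -
    have "D \<le> k"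
      using that by simp
    then obtain a b c where "wt a b c = k"
      by (rule ex_wt_eq)
    then show ?thesis
      using z_val[of a b c] unfolding gen_monomials_def mon_def[symmetric] by blast
  qed
  have gen: "ideal_gen (f ` {two_delta r s u p ..< two_delta r s u p + u * s})
      = J_ideal r s u p \<epsilon>"
    if "\<forall>k \<in> {two_delta r s u p ..< two_delta r s u p + u * s}.
      f k \<in> gen_monomials r s \<and> z_val (x_ser r u p \<epsilon>) (y_ser s u) (f k) = enat k"
    for f :: "nat \<Rightarrow> 'a fps fps"
    unfolding J_eq
  proof (rule ideal_gen_eq_J)
    fix k
    assume "k \<in> {two_delta r s u p ..< two_delta r s u p + u * s}"
    with that have "f k \<in> gen_monomials r s" "z_val (x_ser r u p \<epsilon>) (y_ser s u) (f k) = enat k"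
      by blast+
    then show "\<exists>a b c. f k = mon a b c \<and> wt a b c = k"
      unfolding gen_monomials_def mon_def[symmetric] by (auto simp: z_val) blast
  qed
  show ?thesis
    using F assms(9) ex gen by blast
qed

end
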